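(* Assume $\mathbf{M}=\mathbf{D}^{1/2}$, so that $\mathbf{K}=\mathbf{D}^{-1/2}\mathbf{T}\mathbf{D}^{1/2}$. Let $\mathcal{W}$ be either $\mathcal{W}^{(1)}_J$ or $\mathcal{W}^{(2)}_J$, let $\Pi\in S_n$, $G'=\Pi(G)$, and let $\mathcal{W}'=\{\Pi\Psi_j\Pi^T,\Pi\Phi\Pi^T\}_{0\le j\le J}$ be the corresponding wavelet transform on $G'$. Let $t=2^{J-1}$ if $\mathcal{W}=\mathcal{W}^{(1)}_J$ and $t=2^J$ if $\mathcal{W}=\mathcal{W}^{(2)}_J$. Then, for all $\mathbf{x}\in\mathbf{L}^2(\mathbf{D}^{1/2})$, $$\|\mathbf{S}'_J\Pi\mathbf{x}-\mathbf{S}_J\mathbf{x}\|_{\mathbf{D}^{1/2}}\le\lambda_1^{t}\,\|\Pi-\mathbf{I}\|_{\mathbf{D}^{1/2}}\Big(1+\frac{\|\mathbf{d}\|_1}{\mathbf{d}_{\min}}\Big)^{1/2}\|\mathbf{x}\|_{\mathbf{D}^{1/2}} .$$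
   Context: Let $G=(V,E,W)$ be a weighted, connected (undirected) graph with vertices $\{0,\dots,n-1\}$, weighted adjacency matrix $\mathbf{A}$, weighted degree vector $\mathbf{d}$, $\mathbf{d}_{\min}=\min_i\mathbf{d}(i)$, and $\mathbf{D}=\mathrm{diag}(\mathbf{d})$. Let $\mathbf{N}=\mathbf{I}-\mathbf{D}^{-1/2}\mathbf{A}\mathbf{D}^{-1/2}$ have eigenvalues $0=\omega_0<\omega_1\le\dots\le\omega_{n-1}\le 2$ and orthonormal eigenbasis $\mathbf{v}_0,\dots,\mathbf{v}_{n-1}$ of $\mathbb{R}^n$, $\mathbf{N}\mathbf{v}_i=\omega_i\mathbf{v}_i$, with $\mathbf{v}_0=\mathbf{d}^{1/2}/\|\mathbf{d}^{1/2}\|_2$ (square root componentwise), and let $\mathbf{V}$ be the orthogonal matrix with columns $\mathbf{v}_i$. Let $g:[0,2]\to[0,1]$ be a monotonically decreasing function with $g(0)=1$, $g(2)=0$; put $\lambda_i=g(\omega_i)$, so $1=\lambda_0>\lambda_1\ge\dots\ge\lambda_{n-1}\ge 0$, $\Lambda=\mathrm{diag}(\lambda_0,\dots,\lambda_{n-1})$ and $\mathbf{T}=\mathbf{V}\Lambda\mathbf{V}^T$. For an invertible matrix $\mathbf{M}$, $\mathbf{K}=\mathbf{M}^{-1}\mathbf{T}\mathbf{M}$ and $\mathbf{L}^2(\mathbf{M})$ is $\mathbb{R}^n$ with norm $\|\mathbf{x}\|_{\mathbf{M}}=\|\mathbf{M}\mathbf{x}\|_2$; for a matrix $\mathbf{B}$,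 $\|\mathbf{B}\|_{\mathbf{M}}$ is its operator norm on $\mathbf{L}^2(\mathbf{M})$. Here $\mathbf{M}=\mathbf{D}^{1/2}$. For $J\ge0$ let $p_0(t)=1-t$, $p_j(t)=t^{2^{j-1}}-t^{2^j}$ for $1\le j\le J$, $p_{J+1}(t)=t^{2^J}$, and $q_j=p_j^{1/2}$ on $[0,1]$. For a function $f$ on $[0,1]$, $f(\mathbf{K})=\mathbf{M}^{-1}\mathbf{V}f(\Lambda)\mathbf{V}^T\mathbf{M}$ with $f$ applied to the diagonal entries of $\Lambda$. $\mathcal{W}^{(1)}_J$ consists of $\Psi_j=q_j(\mathbf{K})$ ($0\le j\le J$) and $\Phi=q_{J+1}(\mathbf{K})$; $\mathcal{W}^{(2)}_J$ consists of $\Psi_j=p_j(\mathbf{K})$ ($0\le j\le J$) and $\Phi=p_{J+1}(\mathbf{K})$. Let $M$ denote the entrywise absolute value on $\mathbb{R}^n$ and $\mathcal{J}=\{0,\dots,J\}$. For a path $\mathbf{p}=(j_1,\dots,j_m)\in\mathcal{J}^m$ set $\mathbf{U}[\mathbf{p}]\mathbf{x}=M\Psi_{j_m}\cdots M\Psi_{j_1}\mathbf{x}$ (for the empty path, $m=0$, $\mathbf{U}[\mathbf{p}]\mathbf{x}=\mathbf{x}$), $\mathbf{S}_J[\mathbf{p}]\mathbf{x}=\Phi\mathbf{U}[\mathbf{p}]\mathbf{x}$, and $\mathbf{S}_J\mathbf{x}=\{\mathbf{S}_J[\mathbf{p}]\mathbf{x}\}$ indexed by all paths of all lengths $m\ge0$.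 A permutation is identified with its permutation matrix, $\Pi(G)$ is the graph obtained by permuting the vertices of $G$, and $\mathbf{S}'_J$ is built in the same way from $\mathcal{W}'$. For families, $\|\{\mathbf{y}_{\mathbf{p}}\}\|_{\mathbf{M}}^2=\sum_{\mathbf{p}}\|\mathbf{y}_{\mathbf{p}}\|_{\mathbf{M}}^2$. *)

theory Defs
  imports "HOL-Analysis.Analysis"
begin

text \<open>
  The vertex set $\{0,\dots,n-1\}$ is a finite linearly ordered type \<open>'n\<close> with \<open>CARD('n) = n\<close>; the
  same type indexes the eigenvalues, so that the matrix of eigenvectors is an ordinary square
  matrix. The indices $0$ and $1$ are the least and second least elements of the type.
\<close>

definition index0 :: "'n::{finite,linorder}" where
  "index0 = Min UNIV"

definition index1 :: "'n::{finite,linorder}" where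
  "index1 = Min (UNIV - {index0})"


section \<open>Weighted graphs\<close>

text \<open>
  An undirected edge is a symmetric pair of arcs. Loops are not excluded; values of \<open>W\<close> off \<open>E\<close>
  are irrelevant.
\<close>

definition weighted_graph :: "('n \<times> 'n) set \<Rightarrow> ('n \<Rightarrow> 'n \<Rightarrow> real) \<Rightarrow> bool" where
  "weighted_graph E W \<longleftrightarrow> sym E \<and> (\<forall>(i, j) \<in> E. W i j > 0 \<and> W i j = W j i)"

definition connected_graph :: "('n \<times> 'n) set \<Rightarrow> bool" where
  "connected_graph E \<longleftrightarrow> (\<forall>i j. (i, j) \<in> E\<^sup>*)"

definition adjacency :: "('n::finite \<times> 'n) set \<Rightarrow> ('n \<Rightarrow> 'n \<Rightarrow> real) \<Rightarrow> real^'n^'n" where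
  "adjacency E W = (\<chi> i j. if (i, j) \<in> E then W i j else 0)"

definition degree_vec :: "real^'n^'n \<Rightarrow> real^'n::finite" where
  "degree_vec A = (\<chi> i. \<Sum>j\<in>UNIV. A $ i $ j)"

definition sqrt_vec :: "real^'n \<Rightarrow> real^'n::finite" where
  "sqrt_vec x = (\<chi> i. sqrt (x $ i))"

definition norm1 :: "real^'n::finite \<Rightarrow> real" where
  "norm1 x = (\<Sum>i\<in>UNIV. \<bar>x $ i\<bar>)"

definition min_entry :: "real^'n::finite \<Rightarrow> real" where
  "min_entry x = Min (range (\<lambda>i. x $ i))"

definition diag_matrix :: "real^'n \<Rightarrow> real^'n^'n::finite" where
  "diag_matrix x = (\<chi> i j. if i = j then x $ i else 0)"

definition sqrt_degree_matrix :: "real^'n^'n \<Rightarrow> real^'n^'n::finite" where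
  "sqrt_degree_matrix A = diag_matrix (sqrt_vec (degree_vec A))"

definition normalized_laplacian :: "real^'n^'n \<Rightarrow> real^'n^'n::finite" where
  "normalized_laplacian A =
     mat 1 - matrix_inv (sqrt_degree_matrix A) ** A ** matrix_inv (sqrt_degree_matrix A)"


section \<open>Weighted norms and functional calculus\<close>

definition weighted_norm :: "real^'n^'n \<Rightarrow> real^'n::finite \<Rightarrow> real" where
  "weighted_norm M x = norm (M *v x)"

text \<open>As in \<^const>\<open>onorm\<close>, the quotient at $x = 0$ is $0$.\<close>

definition weighted_opnorm :: "real^'n^'n \<Rightarrow> real^'n^'n::finite \<Rightarrow> real" where
  "weighted_opnorm M B = (SUP x. weighted_norm M (B *v x) / weighted_norm M x)"

text \<open>
  $f(K) = M^{-1} V f(\Lambda) V^T M$, where $\Lambda$ is the diagonal matrix with entries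
  \<open>lam i\<close> and the columns of $V$ are the vectors \<open>v i\<close>.
\<close>

definition columns_matrix :: "('n \<Rightarrow> real^'n) \<Rightarrow> real^'n^'n::finite" where
  "columns_matrix v = (\<chi> i j. v j $ i)"

definition fun_of_K ::
    "real^'n^'n \<Rightarrow> ('n \<Rightarrow> real^'n) \<Rightarrow> ('n \<Rightarrow> real) \<Rightarrow> (real \<Rightarrow> real) \<Rightarrow> real^'n^'n::finite" where
  "fun_of_K M v lam f =
     matrix_inv M ** columns_matrix v ** diag_matrix (\<chi> i. f (lam i)) ** transpose (columns_matrix v) ** M"


section \<open>Wavelets\<close>

definition p_fun :: "nat \<Rightarrow> nat \<Rightarrow> real \<Rightarrow> real" where
  "p_fun J j t =
     (if j = 0 then 1 - t
      else if j \<le> J then t ^ (2 ^ (j - 1)) - t ^ (2 ^ j)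
      else t ^ (2 ^ J))"

definition q_fun :: "nat \<Rightarrow> nat \<Rightarrow> real \<Rightarrow> real" where
  "q_fun J j t = sqrt (p_fun J j t)"

text \<open>
  A wavelet transform is a pair $(\Psi, \Phi)$; only $\Psi_0,\dots,\Psi_J$ are relevant. The index
  $J + 1$ selects the low-pass function.
\<close>

type_synonym 'n wavelets = "(nat \<Rightarrow> real^'n^'n) \<times> (real^'n^'n)"

definition wavelets1 ::
    "nat \<Rightarrow> real^'n^'n \<Rightarrow> ('n \<Rightarrow> real^'n) \<Rightarrow> ('n \<Rightarrow> real) \<Rightarrow> 'n::finite wavelets" where
  "wavelets1 J M v lam = (\<lambda>j. fun_of_K M v lam (q_fun J j), fun_of_K M v lam (q_fun J (J + 1)))"

definition wavelets2 ::
    "nat \<Rightarrow> real^'n^'n \<Rightarrow> ('n \<Rightarrow> real^'n) \<Rightarrow> ('n \<Rightarrow> real) \<Rightarrow> 'n::finite wavelets" where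
  "wavelets2 J M v lam = (\<lambda>j. fun_of_K M v lam (p_fun J j), fun_of_K M v lam (p_fun J (J + 1)))"

text \<open>The convention is $\Pi e_j = e_{\pi(j)}$.\<close>

definition perm_matrix :: "('n \<Rightarrow> 'n) \<Rightarrow> real^'n^'n::finite" where
  "perm_matrix \<pi> = (\<chi> i j. if i = \<pi> j then 1 else 0)"

text \<open>
  The wavelet transform on the permuted graph $\Pi(G)$, which has adjacency matrix
  $\Pi A \Pi^T$, is given directly by its matrices $\Pi \Psi_j \Pi^T$ and $\Pi \Phi \Pi^T$.
\<close>

definition permuted_wavelets :: "real^'n^'n \<Rightarrow> 'n wavelets \<Rightarrow> 'n::finite wavelets" where
  "permuted_wavelets P \<W> =
     (\<lambda>j. P ** fst \<W> j ** transpose P, P ** snd \<W> ** transpose P)"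


section \<open>Scattering transform\<close>

text \<open>
  The path $(j_1,\dots,j_m)$ is a list whose head is applied first; the absolute value on
  \<open>real^'n\<close> is entrywise.
\<close>

definition scattering_U :: "'n::finite wavelets \<Rightarrow> nat list \<Rightarrow> real^'n \<Rightarrow> real^'n" where
  "scattering_U \<W> js x = fold (\<lambda>j y. \<bar>fst \<W> j *v y\<bar>) js x"

definition scattering_S :: "'n::finite wavelets \<Rightarrow> nat list \<Rightarrow> real^'n \<Rightarrow> real^'n" where
  "scattering_S \<W> js x = snd \<W> *v scattering_U \<W> js x"

definition paths :: "nat \<Rightarrow> nat list set" where
  "paths J = lists {0..J}"

text \<open>
  \<^const>\<open>infsum\<close> is $0$ for a divergent sum, so \<open>family_norm\<close> is meaningful only for families
  satisfying \<open>finite_family_norm\<close>.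
\<close>

definition finite_family_norm :: "real^'n^'n \<Rightarrow> 'i set \<Rightarrow> ('i \<Rightarrow> real^'n::finite) \<Rightarrow> bool" where
  "finite_family_norm M I y \<longleftrightarrow> (\<lambda>i. (weighted_norm M (y i))\<^sup>2) summable_on I"

definition family_norm :: "real^'n^'n \<Rightarrow> 'i set \<Rightarrow> ('i \<Rightarrow> real^'n::finite) \<Rightarrow> real" where
  "family_norm M I y = sqrt (\<Sum>\<^sub>\<infinity>i\<in>I. (weighted_norm M (y i))\<^sup>2)"

end

theory Submission
  imports Defs
begin

text \<open>
  Conjugation by \<open>\<Pi>\<close> commutes with the entrywise absolute value, so the path \<open>p\<close> component of the
  difference is \<open>(\<Pi> - I) \<Phi> U[p] x\<close>. The eigenvector \<open>v\<^sub>0\<close> contributes a constant vector to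
  \<open>\<Phi> U[p] x\<close>, which \<open>\<Pi> - I\<close> annihilates; on the other eigenvectors \<open>\<Phi>\<close> contracts by
  \<open>\<lambda>\<^sub>1\<^sup>t\<close>. It remains to bound the energy \<open>\<Sum>\<^sub>p \<parallel>U[p] x\<parallel>\<^sup>2\<close>. The wavelets \<open>\<Psi>\<^sub>j\<close> vanish on
  \<open>v\<^sub>0\<close>, and a nonnegative vector has at least the fraction \<open>d\<^sub>m\<^sub>i\<^sub>n / \<parallel>d\<parallel>\<^sub>1\<close> of its energy in the
  direction \<open>v\<^sub>0\<close>. Hence each layer after the first loses that fraction of the energy.
\<close>

section \<open>Diagonal and orthogonal matrices\<close>

lemma diag_matrix_mult_vec: "(diag_matrix a *v x) $ i = a $ i * x $ i"
  by (simp add: diag_matrix_def matrix_vector_mult_def if_distrib[of "\<lambda>u. u * _"] cong: if_cong)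

lemma diag_matrix_mult:
  "diag_matrix a ** diag_matrix b = diag_matrix (\<chi> i. a $ i * b $ i)"
  by (subst matrix_eq) (simp add: vec_eq_iff diag_matrix_mult_vec flip: matrix_vector_mul_assoc)

lemma diag_matrix_1: "diag_matrix (\<chi> i. 1) = mat 1"
  by (simp add: diag_matrix_def mat_def vec_eq_iff)

lemma
  assumes "invertible A"
  shows matrix_inv_right: "A ** matrix_inv A = mat 1"
    and matrix_inv_left: "matrix_inv A ** A = mat 1"
  unfolding matrix_inv_def
  using someI_ex[OF assms[unfolded invertible_def]] by blast+

lemma
  assumes "\<And>i. a $ i \<noteq> 0"
  shows invertible_diag_matrix: "invertible (diag_matrix a)"
    and matrix_inv_diag_matrix: "matrix_inv (diag_matrix a) = diag_matrix (\<chi> i. 1 / a $ i)"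
proof -
  let ?b = "\<chi> i. 1 / a $ i"
  have ab: "diag_matrix a ** diag_matrix ?b = mat 1" "diag_matrix ?b ** diag_matrix a = mat 1"
    using assms by (simp_all add: diag_matrix_mult diag_matrix_1)
  then show inv: "invertible (diag_matrix a)"
    unfolding invertible_def by blast
  have "matrix_inv (diag_matrix a) = (diag_matrix ?b ** diag_matrix a) ** matrix_inv (diag_matrix a)"
    by (simp add: ab)
  also have "\<dots> = diag_matrix ?b"
    by (simp add: matrix_inv_right[OF inv] flip: matrix_mul_assoc)
  finally show "matrix_inv (diag_matrix a) = diag_matrix ?b" .
qed

lemma norm_vec_squared: "(norm (x :: real^'n))\<^sup>2 = (\<Sum>i\<in>UNIV. (x $ i)\<^sup>2)"
  unfolding power2_norm_eq_inner inner_vec_def by (simp add: power2_eq_square)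

section \<open>Coefficients in an orthonormal basis and the functional calculus\<close>

lemma transpose_columns_matrix_mult: "(transpose (columns_matrix v) *v z) $ i = v i \<bullet> z"
  by (simp add: columns_matrix_def transpose_def matrix_vector_mult_def inner_vec_def)

lemma transpose_columns_matrix_self:
  assumes "\<And>i j. v i \<bullet> v j = (if i = j then 1 else 0)"
  shows "transpose (columns_matrix v) ** columns_matrix v = mat 1"
  using assms
  by (simp add: vec_eq_iff matrix_matrix_mult_def transpose_def columns_matrix_def mat_def inner_vec_def)

text \<open>There are as many vectors \<open>v i\<close> as dimensions, so
  \<open>columns_matrix v\<close> is orthogonal. Its transpose is then orthogonal too and sends
  \<open>z\<close> to its coefficients without changing the norm.\<close>

lemma parseval_columns:
  fixes z :: "real^'n::finite" and v :: "'n \<Rightarrow> real^'n"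
  assumes "\<And>i j. v i \<bullet> v j = (if i = j then 1 else 0)"
  shows "(norm z)\<^sup>2 = (\<Sum>i\<in>UNIV. (v i \<bullet> z)\<^sup>2)"
proof -
  have "orthogonal_matrix (columns_matrix v)"
    using transpose_columns_matrix_self[OF assms] by (simp add: orthogonal_matrix)
  then have "orthogonal_matrix (transpose (columns_matrix v))"
    by simp
  then have "norm (transpose (columns_matrix v) *v z) = norm z"
    using orthogonal_transformation_matrix orthogonal_transformation_norm
    by (metis matrix_of_matrix_vector_mul matrix_vector_mul_linear)
  then show ?thesis
    by (metis (no_types, lifting) norm_vec_squared transpose_columns_matrix_mult sum.cong)
qed

text \<open>Multiplying \<open>fun_of_K M v lam f\<close> by \<open>M\<close> cancels
  \<open>matrix_inv M\<close> and leaves \<open>V f(\<Lambda>) V^T M\<close>, which is diagonal on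
  the coefficients of \<open>M *v y\<close>. All spectral estimates below are read off from these
  coefficients.\<close>

lemma inner_fun_of_K:
  assumes "invertible M" and on: "\<And>i j. v i \<bullet> v j = (if i = j then 1 else 0)"
  shows "v i \<bullet> (M *v (fun_of_K M v lam f *v y)) = f (lam i) * (v i \<bullet> (M *v y))"
proof -
  let ?V = "columns_matrix v" and ?D = "diag_matrix (\<chi> i. f (lam i))"
  have MK: "M ** fun_of_K M v lam f = ?V ** ?D ** transpose ?V ** M"
    unfolding fun_of_K_def by (simp add: matrix_mul_assoc matrix_inv_right[OF assms(1)])
  have "transpose ?V ** (M ** fun_of_K M v lam f) = (transpose ?V ** ?V) ** ?D ** transpose ?V ** M"
    unfolding MK by (simp add: matrix_mul_assoc)
  also have "\<dots> = ?D ** transpose ?V ** M"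
    using transpose_columns_matrix_self[OF on] by simp
  finally have "transpose ?V *v (M *v (fun_of_K M v lam f *v y)) = ?D *v (transpose ?V *v (M *v y))"
    by (simp add: matrix_vector_mul_assoc matrix_mul_assoc)
  then show ?thesis
    by (metis (no_types, lifting) diag_matrix_mult_vec transpose_columns_matrix_mult vec_lambda_beta)
qed

section \<open>The weighted operator norm\<close>

lemma weighted_norm_nonneg: "0 \<le> weighted_norm M x"
  by (simp add: weighted_norm_def)

text \<open>A real supremum is informative only for a bounded set. The quotients are bounded
  because, after the substitution \<open>M *v x\<close>, they are those of the ordinary operator
  norm of \<open>M ** B ** matrix_inv M\<close>.\<close>

lemma
  assumes "invertible M"
  shows weighted_norm_le_opnorm:
      "weighted_norm M (B *v x) \<le> weighted_opnorm M B * weighted_norm M x"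
    and weighted_opnorm_nonneg: "0 \<le> weighted_opnorm M B"
proof -
  let ?C = "M ** B ** matrix_inv M"
  let ?q = "\<lambda>x. weighted_norm M (B *v x) / weighted_norm M x"
  have C: "?C *v (M *v y) = M *v (B *v y)" for y
    by (metis assms matrix_inv_left matrix_mul_assoc matrix_mul_rid matrix_vector_mul_assoc)
  have bl: "bounded_linear ((*v) ?C)"
    by simp
  have "?q y \<le> onorm ((*v) ?C)" for y
    unfolding weighted_norm_def C[symmetric]
    using onorm[OF bl, of "M *v y"] onorm_pos_le[OF bl]
    by (cases "norm (M *v y) = 0") (auto simp: divide_le_eq)
  then have bdd: "bdd_above (range ?q)"
    by (intro bdd_aboveI2)
  have q: "?q y \<le> weighted_opnorm M B" for y
    unfolding weighted_opnorm_def by (rule cSUP_upper[OF _ bdd]) simp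
  show "0 \<le> weighted_opnorm M B"
    \<comment> \<open>At the zero vector the quotient is \<open>0 / 0 = 0\<close>, so the supremum
      is at least \<open>0\<close>.\<close>
    using q[of 0] by (simp add: weighted_norm_def)
  show "weighted_norm M (B *v x) \<le> weighted_opnorm M B * weighted_norm M x"
  proof (cases "weighted_norm M x = 0")
    case True
    then have "M *v (B *v x) = 0"
      unfolding weighted_norm_def using C[of x] by simp
    then show ?thesis
      using True by (simp add: weighted_norm_def)
  next
    case False
    then have "weighted_norm M x > 0"
      using weighted_norm_nonneg[of M x] by linarith
    then show ?thesis
      using q[of x] by (simp add: divide_le_eq)
  qed
qed

section \<open>Permutations\<close>

lemma perm_matrix_mult_vec:
  assumes "\<pi> permutes UNIV"
  shows "(perm_matrix \<pi> *v x) $ i = x $ inv \<pi> i"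
proof -
  have "i = \<pi> j \<longleftrightarrow> j = inv \<pi> i" for j
    using assms by (metis permutes_inverses(1,2))
  then show ?thesis
    by (simp add: perm_matrix_def matrix_vector_mult_def if_distrib[of "\<lambda>u. u * _"] cong: if_cong)
qed

lemma transpose_perm_matrix_self:
  assumes "\<pi> permutes UNIV"
  shows "transpose (perm_matrix \<pi>) ** perm_matrix \<pi> = mat 1"
proof -
  have "\<pi> i = \<pi> j \<longleftrightarrow> i = j" for i j
    using permutes_inj[OF assms] by (auto dest: injD)
  then show ?thesis
    by (simp add: vec_eq_iff matrix_matrix_mult_def transpose_def perm_matrix_def mat_def
        if_distrib[of "\<lambda>u. u * _"] cong: if_cong)
qed

lemma permuted_wavelets_mult:
  assumes "\<pi> permutes UNIV" and "P = perm_matrix \<pi>"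
  shows "fst (permuted_wavelets P \<W>) j *v (P *v y) = P *v (fst \<W> j *v y)"
    and "snd (permuted_wavelets P \<W>) *v (P *v y) = P *v (snd \<W> *v y)"
proof -
  have "(P ** B ** transpose P) *v (P *v y) = P *v (B *v y)" for B
    unfolding matrix_vector_mul_assoc
    using transpose_perm_matrix_self[OF assms(1)]
    by (metis assms(2) matrix_mul_assoc matrix_mul_rid)
  then show "fst (permuted_wavelets P \<W>) j *v (P *v y) = P *v (fst \<W> j *v y)"
    and "snd (permuted_wavelets P \<W>) *v (P *v y) = P *v (snd \<W> *v y)"
    by (simp_all add: permuted_wavelets_def)
qed

lemma abs_perm_matrix_mult_vec:
  assumes "\<pi> permutes UNIV"
  shows "\<bar>perm_matrix \<pi> *v y\<bar> = perm_matrix \<pi> *v \<bar>y\<bar>"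
  by (simp add: vec_eq_iff perm_matrix_mult_vec[OF assms] abs_vec_def)

text \<open>The factor \<open>P\<close> passes through each layer in turn:
  \<open>transpose P ** P = mat 1\<close> cancels inside the filter, and permuting entries commutes
  with taking absolute values.\<close>

lemma scattering_permuted:
  assumes "\<pi> permutes UNIV" and "P = perm_matrix \<pi>"
  shows "scattering_S (permuted_wavelets P \<W>) js (P *v x) = P *v scattering_S \<W> js x"
proof -
  have "scattering_U (permuted_wavelets P \<W>) js (P *v x) = P *v scattering_U \<W> js x"
    by (induction js arbitrary: x)
      (simp_all add: scattering_U_def permuted_wavelets_mult[OF assms]
        abs_perm_matrix_mult_vec[OF assms(1), folded assms(2)])
  then show ?thesis
    by (simp add: scattering_S_def permuted_wavelets_mult[OF assms])
qed

section \<open>Energy of the scattering paths\<close>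

text \<open>These finite sets exhaust the infinite set \<open>paths J\<close>, and every finite set
  of paths lies in one of them. Energy bounds can thus be proved by induction on
  \<open>N\<close>.\<close>

definition short_paths :: "nat \<Rightarrow> nat \<Rightarrow> nat list set" where
  "short_paths J N = {js \<in> paths J. length js \<le> N}"

lemma short_paths_alt: "short_paths J N = {js. set js \<subseteq> {0..J} \<and> length js \<le> N}"
  by (auto simp: short_paths_def paths_def)

lemma finite_short_paths: "finite (short_paths J N)"
  unfolding short_paths_alt by (rule finite_lists_length_le) simp

lemma short_paths_Suc:
  "short_paths J (Suc N) = insert [] ((\<lambda>(j, js). j # js) ` ({0..J} \<times> short_paths J N))"
proof -
  have "js \<in> short_paths J (Suc N) \<longleftrightarrow>
      js \<in> insert [] ((\<lambda>(j, js). j # js) ` ({0..J} \<times> short_paths J N))" for js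
    by (cases js) (auto simp: short_paths_alt image_iff)
  then show ?thesis
    by blast
qed

lemma sum_short_paths_Suc:
  fixes f :: "nat list \<Rightarrow> real"
  shows "sum f (short_paths J (Suc N)) = f [] + (\<Sum>j\<in>{0..J}. \<Sum>js\<in>short_paths J N. f (j # js))"
proof -
  have "inj_on (\<lambda>(j, js). j # js) ({0..J} \<times> short_paths J N)"
    by (auto simp: inj_on_def)
  moreover have "[] \<notin> (\<lambda>(j, js). j # js) ` ({0..J} \<times> short_paths J N)"
    by auto
  ultimately show ?thesis
    unfolding short_paths_Suc
    by (simp add: finite_short_paths sum.reindex sum.cartesian_product case_prod_unfold o_def)
qed

lemma finite_subset_short_paths:
  assumes "finite F" and "F \<subseteq> paths J"
  obtains N where "F \<subseteq> short_paths J N"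
proof
  show "F \<subseteq> short_paths J (Max (insert 0 (length ` F)))"
    using assms by (auto simp: short_paths_def)
qed

lemma scattering_U_Cons: "scattering_U \<W> (j # js) x = scattering_U \<W> js \<bar>fst \<W> j *v x\<bar>"
  by (simp add: scattering_U_def)

text \<open>The bound is the geometric series \<open>1 + (1 - c) + (1 - c)^2 + ... = 1 / c\<close>.
  Splitting off the first filter keeps the induction going, since the absolute value of its output
  is again a nonnegative vector.\<close>

lemma scattering_U_energy_nonneg:
  assumes "c > 0"
    and abs: "\<And>y. weighted_norm M \<bar>y\<bar> = weighted_norm M y"
    and decay: "\<And>y. (\<And>i. 0 \<le> y $ i) \<Longrightarrow>
      (\<Sum>j\<in>{0..J}. (weighted_norm M (fst \<W> j *v y))\<^sup>2) \<le> (1 - c) * (weighted_norm M y)\<^sup>2"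
    and "\<And>i. 0 \<le> y $ i"
  shows "(\<Sum>js\<in>short_paths J N. (weighted_norm M (scattering_U \<W> js y))\<^sup>2)
    \<le> (1 / c) * (weighted_norm M y)\<^sup>2"
  using assms(4)
proof (induction N arbitrary: y)
  case 0
  \<comment> \<open>This takes the place of \<open>c \<le> 1\<close>: the left side of
    \<open>decay\<close> is nonnegative, so the energy of \<open>y\<close> is at most
    \<open>1 / c\<close> times itself.\<close>
  have c1: "(1 - c) * (weighted_norm M y)\<^sup>2 \<ge> 0"
    using decay[OF 0] sum_nonneg[of "{0..J}" "\<lambda>j. (weighted_norm M (fst \<W> j *v y))\<^sup>2"]
    by simp
  have "short_paths J 0 = {[]}"
    by (auto simp: short_paths_alt)
  then show ?case
    using c1 \<open>c > 0\<close> by (simp add: scattering_U_def field_simps)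
next
  case (Suc N)
  have "(\<Sum>js\<in>short_paths J (Suc N). (weighted_norm M (scattering_U \<W> js y))\<^sup>2)
      = (weighted_norm M y)\<^sup>2 + (\<Sum>j\<in>{0..J}. \<Sum>js\<in>short_paths J N.
          (weighted_norm M (scattering_U \<W> js \<bar>fst \<W> j *v y\<bar>))\<^sup>2)"
    by (simp add: sum_short_paths_Suc scattering_U_Cons) (simp add: scattering_U_def)
  also have "\<dots> \<le> (weighted_norm M y)\<^sup>2 + (\<Sum>j\<in>{0..J}. (1 / c) * (weighted_norm M \<bar>fst \<W> j *v y\<bar>)\<^sup>2)"
    by (intro add_left_mono sum_mono Suc.IH) (simp add: abs_vec_def)
  also have "\<dots> = (weighted_norm M y)\<^sup>2 + (1 / c) * (\<Sum>j\<in>{0..J}. (weighted_norm M (fst \<W> j *v y))\<^sup>2)"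
    by (simp add: abs sum_distrib_left)
  also have "\<dots> \<le> (weighted_norm M y)\<^sup>2 + (1 / c) * ((1 - c) * (weighted_norm M y)\<^sup>2)"
    using \<open>c > 0\<close> by (intro add_left_mono mult_left_mono decay Suc.prems) simp_all
  also have "\<dots> = (1 / c) * (weighted_norm M y)\<^sup>2"
    using \<open>c > 0\<close> by (simp add: field_simps)
  finally show ?case .
qed

text \<open>The entries of \<open>x\<close> may have any sign, so the first layer is controlled only
  by the Bessel bound. From then on all vectors are nonnegative. The empty path contributes
  \<open>1\<close> and the remaining layers \<open>1 / c\<close>.\<close>

lemma scattering_U_energy:
  assumes "c > 0"
    and abs: "\<And>y. weighted_norm M \<bar>y\<bar> = weighted_norm M y"
    and decay: "\<And>y. (\<And>i. 0 \<le> y $ i) \<Longrightarrow>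
      (\<Sum>j\<in>{0..J}. (weighted_norm M (fst \<W> j *v y))\<^sup>2) \<le> (1 - c) * (weighted_norm M y)\<^sup>2"
    and bessel: "(\<Sum>j\<in>{0..J}. (weighted_norm M (fst \<W> j *v x))\<^sup>2) \<le> (weighted_norm M x)\<^sup>2"
    and F: "finite F" "F \<subseteq> paths J"
  shows "(\<Sum>js\<in>F. (weighted_norm M (scattering_U \<W> js x))\<^sup>2) \<le> (1 + 1 / c) * (weighted_norm M x)\<^sup>2"
proof -
  let ?f = "\<lambda>js. (weighted_norm M (scattering_U \<W> js x))\<^sup>2"
  obtain N where N: "F \<subseteq> short_paths J N"
    using finite_subset_short_paths[OF F] .
  \<comment> \<open>A successor as length bound allows the first filter to be split off.\<close>
  also have "\<dots> \<subseteq> short_paths J (Suc N)"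
    by (auto simp: short_paths_def)
  finally have "sum ?f F \<le> sum ?f (short_paths J (Suc N))"
    by (intro sum_mono2) (simp_all add: finite_short_paths)
  also have "\<dots> = (weighted_norm M x)\<^sup>2 + (\<Sum>j\<in>{0..J}. \<Sum>js\<in>short_paths J N.
          (weighted_norm M (scattering_U \<W> js \<bar>fst \<W> j *v x\<bar>))\<^sup>2)"
    by (simp add: sum_short_paths_Suc scattering_U_Cons) (simp add: scattering_U_def)
  also have "\<dots> \<le> (weighted_norm M x)\<^sup>2 + (\<Sum>j\<in>{0..J}. (1 / c) * (weighted_norm M \<bar>fst \<W> j *v x\<bar>)\<^sup>2)"
    by (intro add_left_mono sum_mono scattering_U_energy_nonneg assms) (simp_all add: abs_vec_def)
  also have "\<dots> = (weighted_norm M x)\<^sup>2 + (1 / c) * (\<Sum>j\<in>{0..J}. (weighted_norm M (fst \<W> j *v x))\<^sup>2)"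
    by (simp add: abs sum_distrib_left)
  also have "\<dots> \<le> (weighted_norm M x)\<^sup>2 + (1 / c) * (weighted_norm M x)\<^sup>2"
    using \<open>c > 0\<close> by (intro add_left_mono mult_left_mono bessel) simp_all
  finally show ?thesis
    by (simp add: algebra_simps)
qed

text \<open>For nonnegative terms, one bound on all finite partial sums yields both summability and
  the bound on the infinite sum.\<close>

lemma family_norm_le:
  assumes "0 \<le> b" and "\<And>i. i \<in> I \<Longrightarrow> weighted_norm M (y i) \<le> b * weighted_norm M (u i)"
    and "\<And>F. finite F \<Longrightarrow> F \<subseteq> I \<Longrightarrow> (\<Sum>i\<in>F. (weighted_norm M (u i))\<^sup>2) \<le> e"
  shows "finite_family_norm M I y \<and> family_norm M I y \<le> b * sqrt e"
proof -
  have le: "(\<Sum>i\<in>F. (weighted_norm M (y i))\<^sup>2) \<le> b\<^sup>2 * e" if "finite F" "F \<subseteq> I" for F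
  proof -
    have "(\<Sum>i\<in>F. (weighted_norm M (y i))\<^sup>2) \<le> (\<Sum>i\<in>F. (b * weighted_norm M (u i))\<^sup>2)"
      using that assms(2) by (intro sum_mono power_mono) (auto simp: weighted_norm_nonneg)
    also have "\<dots> = b\<^sup>2 * (\<Sum>i\<in>F. (weighted_norm M (u i))\<^sup>2)"
      by (simp add: power_mult_distrib sum_distrib_left)
    also have "\<dots> \<le> b\<^sup>2 * e"
      using assms(3)[OF that] by (intro mult_left_mono) auto
    finally show ?thesis .
  qed
  have summable: "(\<lambda>i. (weighted_norm M (y i))\<^sup>2) summable_on I"
    by (rule nonneg_bdd_above_summable_on) (use le in \<open>auto intro!: bdd_aboveI\<close>)
  then have "(\<Sum>\<^sub>\<infinity>i\<in>I. (weighted_norm M (y i))\<^sup>2) \<le> b\<^sup>2 * e"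
    by (rule infsum_le_finite_sums) (rule le)
  then have "family_norm M I y \<le> sqrt (b\<^sup>2 * e)"
    unfolding family_norm_def by (rule real_sqrt_le_mono)
  then show ?thesis
    using summable \<open>0 \<le> b\<close> by (simp add: finite_family_norm_def real_sqrt_mult)
qed

section \<open>Wavelet filters\<close>

lemma p_fun_nonneg:
  assumes "t \<in> {0..1}"
  shows "0 \<le> p_fun J j t"
proof -
  have "t ^ (2 ^ j) \<le> t ^ (2 ^ (j - 1))"
    using assms by (intro power_decreasing power_increasing) auto
  then show ?thesis
    using assms by (simp add: p_fun_def)
qed

lemma sum_p_fun: "(\<Sum>j\<in>{0..J}. p_fun J j t) = 1 - t ^ (2 ^ J)"
proof -
  \<comment> \<open>The sum telescopes. The upper limit \<open>k\<close> varies while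
    \<open>J\<close> stays fixed, because \<open>J\<close> also selects the branch of
    \<open>p_fun\<close>.\<close>
  have "k \<le> J \<Longrightarrow> (\<Sum>j\<in>{0..k}. p_fun J j t) = 1 - t ^ (2 ^ k)" for k
    by (induction k) (simp_all add: p_fun_def)
  then show ?thesis
    by simp
qed

lemma p_fun_1: "j \<le> J \<Longrightarrow> p_fun J j 1 = 0"
  by (simp add: p_fun_def)

lemma sum_p_fun_le_1:
  assumes "t \<in> {0..1}"
  shows "(\<Sum>j\<in>{0..J}. p_fun J j t) \<le> 1"
  using assms by (simp add: sum_p_fun)

lemma sum_q_fun_squared_le_1:
  assumes "t \<in> {0..1}"
  shows "(\<Sum>j\<in>{0..J}. (q_fun J j t)\<^sup>2) \<le> 1"
  using sum_p_fun_le_1[OF assms] by (simp add: q_fun_def p_fun_nonneg[OF assms])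

text \<open>Each \<open>p_fun J j t\<close> lies in \<open>[0, 1]\<close>, being one term of a
  nonnegative sum bounded by \<open>1\<close>. Squaring therefore only decreases the terms.\<close>

lemma sum_p_fun_squared_le_1:
  assumes "t \<in> {0..1}"
  shows "(\<Sum>j\<in>{0..J}. (p_fun J j t)\<^sup>2) \<le> 1"
proof -
  have "p_fun J j t \<le> 1" if "j \<in> {0..J}" for j
    using member_le_sum[of j "{0..J}" "\<lambda>j. p_fun J j t"] that
      p_fun_nonneg[OF assms] sum_p_fun_le_1[OF assms, of J]
    by fastforce
  then have "(\<Sum>j\<in>{0..J}. (p_fun J j t)\<^sup>2) \<le> (\<Sum>j\<in>{0..J}. p_fun J j t)"
    unfolding power2_eq_square
    by (intro sum_mono mult_left_le) (use p_fun_nonneg[OF assms] in auto)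
  then show ?thesis
    using sum_p_fun_le_1[OF assms, of J] by linarith
qed

text \<open>Both low-pass filters are put in \<open>powr\<close> form because the exponent for the
  square-root family is \<open>1/2\<close> when \<open>J = 0\<close>. At \<open>s = 0\<close> both
  sides are \<open>0\<close>.\<close>

lemma low_pass_p: "0 \<le> s \<Longrightarrow> p_fun J (J + 1) s = s powr (2 ^ J)"
  by (cases "s = 0") (simp_all add: p_fun_def power_0_left flip: powr_realpow)

lemma low_pass_q: "0 \<le> s \<Longrightarrow> q_fun J (J + 1) s = s powr (2 powr (real J - 1))"
proof -
  assume s: "0 \<le> s"
  have "q_fun J (J + 1) s = (s powr (2 ^ J)) powr (1 / 2)"
    using low_pass_p[OF s, of J] by (simp add: q_fun_def powr_half_sqrt)
  also have "\<dots> = s powr (2 ^ J * (1 / 2))"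
    by (rule powr_powr)
  also have "(2::real) ^ J * (1 / 2) = 2 powr (real J - 1)"
    by (simp add: powr_diff powr_realpow)
  finally show ?thesis .
qed

section \<open>Spectral estimates\<close>

text \<open>The spectral data from which the scattering estimate follows. The graph and its
  Laplacian enter only afterwards, to verify these assumptions.\<close>

locale degree_eigenbasis =
  fixes d :: "(real, 'n::{finite,linorder}) vec" and v :: "'n \<Rightarrow> (real, 'n) vec" and lam :: "'n \<Rightarrow> real"
  assumes degree_pos: "0 < d $ i"
    and orthonormal: "v i \<bullet> v j = (if i = j then 1 else 0)"
    and v_index0: "v index0 = (1 / norm (sqrt_vec d)) *\<^sub>R sqrt_vec d"
    and lam_index0: "lam index0 = 1"
    and lam_range: "lam i \<in> {0..1}"
begin

abbreviation "M \<equiv> diag_matrix (sqrt_vec d)"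

lemma invertible_M: "invertible M"
  using degree_pos by (intro invertible_diag_matrix) (simp add: sqrt_vec_def less_imp_neq[symmetric])

lemma weighted_norm_M: "(weighted_norm M y)\<^sup>2 = (\<Sum>i\<in>UNIV. d $ i * (y $ i)\<^sup>2)"
  using degree_pos
  by (simp add: weighted_norm_def norm_vec_squared diag_matrix_mult_vec sqrt_vec_def
      power_mult_distrib less_imp_le)

lemma weighted_norm_M_spectral: "(weighted_norm M y)\<^sup>2 = (\<Sum>i\<in>UNIV. (v i \<bullet> (M *v y))\<^sup>2)"
  unfolding weighted_norm_def by (rule parseval_columns[OF orthonormal])

text \<open>Since \<open>M\<close> is diagonal, its norm depends only on the squares of the
  entries.\<close>

lemma weighted_norm_M_abs: "weighted_norm M \<bar>y\<bar> = weighted_norm M y"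
proof -
  have "(weighted_norm M \<bar>y\<bar>)\<^sup>2 = (weighted_norm M y)\<^sup>2"
    by (simp add: weighted_norm_M abs_vec_def)
  then show ?thesis
    using power2_eq_imp_eq weighted_norm_nonneg by blast
qed

lemma norm1_d: "norm1 d = (norm (sqrt_vec d))\<^sup>2"
  using degree_pos by (simp add: norm1_def norm_vec_squared sqrt_vec_def less_imp_le abs_of_pos)

lemma norm1_d_pos: "0 < norm1 d"
  unfolding norm1_def using degree_pos by (intro sum_pos) (auto simp: abs_of_pos)

lemma min_entry_le: "min_entry d \<le> d $ i"
  by (simp add: min_entry_def)

lemma min_entry_pos: "0 < min_entry d"
  using degree_pos by (simp add: min_entry_def)

lemma inner_v_index0: "v index0 \<bullet> (M *v y) = (\<Sum>i\<in>UNIV. d $ i * y $ i) / norm (sqrt_vec d)"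
proof -
  have "sqrt_vec d \<bullet> (M *v y) = (\<Sum>i\<in>UNIV. d $ i * y $ i)"
    using degree_pos
    by (simp add: inner_vec_def diag_matrix_mult_vec sqrt_vec_def less_imp_le flip: mult.assoc)
  then show ?thesis
    by (simp add: v_index0)
qed

text \<open>Let \<open>S\<close> be the sum of the nonnegative numbers \<open>d $ i * y $ i\<close>.
  Each of them is at least \<open>min_entry d * y $ i\<close> and at most \<open>S\<close>, so the
  energy times \<open>min_entry d\<close> is at most \<open>S^2\<close>. The squared coefficient is
  \<open>S^2 / norm1 d\<close>.\<close>

lemma energy_v_index0:
  assumes "\<And>i. 0 \<le> y $ i"
  shows "min_entry d / norm1 d * (weighted_norm M y)\<^sup>2 \<le> (v index0 \<bullet> (M *v y))\<^sup>2"
proof -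
  let ?S = "\<Sum>i\<in>UNIV. d $ i * y $ i"
  have nonneg: "0 \<le> d $ i * y $ i" for i
    using assms degree_pos[of i] by simp
  have "min_entry d * (weighted_norm M y)\<^sup>2 = (\<Sum>i\<in>UNIV. d $ i * y $ i * (min_entry d * y $ i))"
    unfolding weighted_norm_M sum_distrib_left by (simp add: power2_eq_square mult_ac)
  also have "\<dots> \<le> (\<Sum>i\<in>UNIV. d $ i * y $ i * (d $ i * y $ i))"
    using nonneg assms min_entry_le by (intro sum_mono mult_left_mono mult_right_mono) auto
  also have "\<dots> \<le> (\<Sum>i\<in>UNIV. d $ i * y $ i * ?S)"
    using nonneg by (intro sum_mono mult_left_mono member_le_sum) auto
  also have "\<dots> = ?S\<^sup>2"
    by (simp add: power2_eq_square flip: sum_distrib_right)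
  finally have "min_entry d * (weighted_norm M y)\<^sup>2 / norm1 d \<le> ?S\<^sup>2 / norm1 d"
    using norm1_d_pos by (intro divide_right_mono) auto
  then show ?thesis
    by (simp add: inner_v_index0 power_divide norm1_d)
qed

text \<open>After exchanging the sums, each squared coefficient carries the weight
  \<open>\<Sum>j. (f j (lam i))^2\<close>, which is at most \<open>1\<close> and vanishes at
  \<open>index0\<close>, where \<open>lam\<close> is \<open>1\<close>. A general \<open>f\<close>
  covers both wavelet families.\<close>

lemma wavelet_energy:
  assumes "\<And>s. s \<in> {0..1} \<Longrightarrow> (\<Sum>j\<in>{0..J}. (f j s)\<^sup>2) \<le> 1"
    and "\<And>j. j \<le> J \<Longrightarrow> f j 1 = 0"
  shows "(\<Sum>j\<in>{0..J}. (weighted_norm M (fun_of_K M v lam (f j) *v y))\<^sup>2)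
    \<le> (weighted_norm M y)\<^sup>2 - (v index0 \<bullet> (M *v y))\<^sup>2"
proof -
  let ?c = "\<lambda>i. (v i \<bullet> (M *v y))\<^sup>2"
  have "(\<Sum>j\<in>{0..J}. (weighted_norm M (fun_of_K M v lam (f j) *v y))\<^sup>2)
      = (\<Sum>j\<in>{0..J}. \<Sum>i\<in>UNIV. (f j (lam i))\<^sup>2 * ?c i)"
    by (simp add: weighted_norm_M_spectral inner_fun_of_K[OF invertible_M orthonormal] power_mult_distrib)
  also have "\<dots> = (\<Sum>i\<in>UNIV. (\<Sum>j\<in>{0..J}. (f j (lam i))\<^sup>2) * ?c i)"
    by (subst sum.swap) (simp add: sum_distrib_right)
  also have "\<dots> = (\<Sum>i\<in>UNIV - {index0}. (\<Sum>j\<in>{0..J}. (f j (lam i))\<^sup>2) * ?c i)"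
    by (subst sum.remove[of UNIV index0]) (simp_all add: lam_index0 assms(2))
  also have "\<dots> \<le> (\<Sum>i\<in>UNIV - {index0}. ?c i)"
    using assms(1) lam_range by (intro sum_mono mult_left_le_one_le) (auto intro: sum_nonneg)
  also have "\<dots> = (weighted_norm M y)\<^sup>2 - ?c index0"
    unfolding weighted_norm_M_spectral by (subst sum_diff1) simp_all
  finally show ?thesis .
qed

lemma perm_low_pass:
  assumes \<pi>: "\<pi> permutes UNIV" and "P = perm_matrix \<pi>"
    and "f 1 = 1" and "0 \<le> r" and f: "\<And>i. i \<noteq> index0 \<Longrightarrow> \<bar>f (lam i)\<bar> \<le> r"
  shows "weighted_norm M ((P - mat 1) *v (fun_of_K M v lam f *v y))
    \<le> r * weighted_opnorm M (P - mat 1) * weighted_norm M y"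
proof -
  let ?b = "v index0 \<bullet> (M *v y)"
  \<comment> \<open>\<open>M\<close> maps the all-ones vector to \<open>sqrt_vec d\<close>, so this
    constant vector is the one for which \<open>M *v k\<close> is the \<open>v index0\<close>
    component of \<open>M *v y\<close>.\<close>
  define k :: "(real, 'n) vec" where "k = (\<chi> i. ?b / norm (sqrt_vec d))"
  define z where "z = fun_of_K M v lam f *v y - k"
  have "(P - mat 1) *v k = 0"
    unfolding assms(2)
    by (simp add: vec_eq_iff perm_matrix_mult_vec[OF \<pi>] matrix_vector_mult_diff_rdistrib k_def)
  then have Pz: "(P - mat 1) *v (fun_of_K M v lam f *v y) = (P - mat 1) *v z"
    by (simp add: z_def matrix_vector_mult_diff_distrib)
  have "M *v k = ?b *\<^sub>R v index0"
    by (simp add: vec_eq_iff k_def v_index0 diag_matrix_mult_vec)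
  \<comment> \<open>Because \<open>f 1 = 1\<close>, the low-pass filter preserves the
    \<open>v index0\<close> component, and subtracting \<open>k\<close> removes exactly
    that.\<close>
  then have vz: "v i \<bullet> (M *v z) = (if i = index0 then 0 else f (lam i) * (v i \<bullet> (M *v y)))" for i
    using \<open>f 1 = 1\<close>
    by (simp add: z_def matrix_vector_mult_diff_distrib inner_diff_right orthonormal lam_index0
        inner_fun_of_K[OF invertible_M orthonormal])
  have "(v i \<bullet> (M *v z))\<^sup>2 \<le> r\<^sup>2 * (v i \<bullet> (M *v y))\<^sup>2" for i
    using f[of i] \<open>0 \<le> r\<close>
    by (auto simp: vz power_mult_distrib abs_le_square_iff[symmetric] intro!: mult_right_mono)
  then have "(weighted_norm M z)\<^sup>2 \<le> (r * weighted_norm M y)\<^sup>2"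
    by (simp add: weighted_norm_M_spectral power_mult_distrib sum_distrib_left sum_mono)
  then have "weighted_norm M z \<le> r * weighted_norm M y"
    by (rule power2_le_imp_le) (simp add: \<open>0 \<le> r\<close> weighted_norm_nonneg)
  then have "weighted_opnorm M (P - mat 1) * weighted_norm M z
      \<le> weighted_opnorm M (P - mat 1) * (r * weighted_norm M y)"
    by (intro mult_left_mono weighted_opnorm_nonneg invertible_M)
  then show ?thesis
    unfolding Pz using weighted_norm_le_opnorm[OF invertible_M, of "P - mat 1" z]
    by (simp add: mult_ac)
qed

lemma scattering_perm_le:
  assumes \<pi>: "\<pi> permutes UNIV" and P: "P = perm_matrix \<pi>"
    and Psi: "\<And>j. fst \<W> j = fun_of_K M v lam (f j)" and Phi: "snd \<W> = fun_of_K M v lam \<phi>"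
    and f: "\<And>s. s \<in> {0..1} \<Longrightarrow> (\<Sum>j\<in>{0..J}. (f j s)\<^sup>2) \<le> 1" "\<And>j. j \<le> J \<Longrightarrow> f j 1 = 0"
    and \<phi>: "\<phi> 1 = 1" and r: "0 \<le> r" "\<And>i. i \<noteq> index0 \<Longrightarrow> \<bar>\<phi> (lam i)\<bar> \<le> r"
  shows "finite_family_norm M (paths J)
           (\<lambda>js. scattering_S (permuted_wavelets P \<W>) js (P *v x) - scattering_S \<W> js x) \<and>
         family_norm M (paths J)
           (\<lambda>js. scattering_S (permuted_wavelets P \<W>) js (P *v x) - scattering_S \<W> js x)
         \<le> r * weighted_opnorm M (P - mat 1)
            * sqrt (1 + norm1 d / min_entry d) * weighted_norm M x"
proof -
  \<comment> \<open>\<open>?c\<close> is the fraction of energy lost per layer according to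
    \<open>energy_v_index0\<close>; the factor \<open>1 + 1 / ?c\<close> becomes
    \<open>1 + norm1 d / min_entry d\<close>.\<close>
  let ?b = "r * weighted_opnorm M (P - mat 1)" and ?c = "min_entry d / norm1 d"
  have b: "0 \<le> ?b"
    using r(1) weighted_opnorm_nonneg[OF invertible_M] by simp
  have step: "weighted_norm M (scattering_S (permuted_wavelets P \<W>) js (P *v x) - scattering_S \<W> js x)
      \<le> ?b * weighted_norm M (scattering_U \<W> js x)" for js
    using perm_low_pass[OF \<pi> P \<phi> r, of "scattering_U \<W> js x"]
    unfolding scattering_permuted[OF \<pi> P]
    by (simp add: scattering_S_def Phi matrix_vector_mult_diff_rdistrib)
  note energy = wavelet_energy[of f J, OF f, folded Psi]
  have decay: "(\<Sum>j\<in>{0..J}. (weighted_norm M (fst \<W> j *v y))\<^sup>2) \<le> (1 - ?c) * (weighted_norm M y)\<^sup>2"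
    if "\<And>i. 0 \<le> y $ i" for y
    using energy[of y] energy_v_index0[OF that] by (simp add: left_diff_distrib)
  have bessel: "(\<Sum>j\<in>{0..J}. (weighted_norm M (fst \<W> j *v x))\<^sup>2) \<le> (weighted_norm M x)\<^sup>2"
    using energy[of x] zero_le_power2[of "v index0 \<bullet> (M *v x)"] by linarith
  have c: "?c > 0"
    using min_entry_pos norm1_d_pos by simp
  have total: "(\<Sum>js\<in>F. (weighted_norm M (scattering_U \<W> js x))\<^sup>2)
      \<le> (1 + 1 / ?c) * (weighted_norm M x)\<^sup>2" if "finite F" "F \<subseteq> paths J" for F
    by (rule scattering_U_energy[OF c weighted_norm_M_abs decay bessel that])
  have "sqrt ((1 + 1 / ?c) * (weighted_norm M x)\<^sup>2)
      = sqrt (1 + norm1 d / min_entry d) * weighted_norm M x"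
    by (simp add: real_sqrt_mult weighted_norm_nonneg)
  then show ?thesis
    using family_norm_le[where I = "paths J" and u = "\<lambda>js. scattering_U \<W> js x", OF b step total]
    by (simp only: mult.assoc)
qed

end

section \<open>The normalized Laplacian\<close>

lemma adjacency_nonneg:
  assumes "weighted_graph E W"
  shows "0 \<le> adjacency E W $ i $ j"
  using assms by (auto simp: weighted_graph_def adjacency_def intro: less_imp_le)

text \<open>A second vertex exists, and the first arc of a path from \<open>i\<close> to it already
  has positive weight.\<close>

lemma degree_vec_pos:
  fixes E :: "('n::finite \<times> 'n) set"
  assumes "weighted_graph E W" and "connected_graph E" and "CARD('n) \<ge> 2"
  shows "0 < degree_vec (adjacency E W) $ i"
proof -
  obtain j where "j \<noteq> i"
  proof -
    have "UNIV \<noteq> {i}"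
    proof
      assume "UNIV = {i}"
      from arg_cong[OF this, of card] show False
        using assms(3) by simp
    qed
    then show thesis
      using that by blast
  qed
  moreover have "(i, j) \<in> E\<^sup>*"
    using assms(2) by (simp add: connected_graph_def)
  ultimately obtain k where "(i, k) \<in> E"
    by (auto elim: converse_rtranclE)
  then have "0 < adjacency E W $ i $ k"
    using assms(1) by (auto simp: weighted_graph_def adjacency_def)
  then show ?thesis
    unfolding degree_vec_def using adjacency_nonneg[OF assms(1)]
    by (auto intro: sum_pos2)
qed

lemma normalized_laplacian_mult_vec:
  assumes "\<And>i. 0 < degree_vec A $ i"
  shows "(normalized_laplacian A *v x) $ i =
    x $ i - (\<Sum>j\<in>UNIV. A $ i $ j * (x $ j / sqrt (degree_vec A $ j))) / sqrt (degree_vec A $ i)"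
proof -
  have nz: "sqrt_vec (degree_vec A) $ i \<noteq> 0" for i
    using assms[of i] by (simp add: sqrt_vec_def)
  let ?R = "diag_matrix (\<chi> i. 1 / sqrt_vec (degree_vec A) $ i)"
  have "normalized_laplacian A *v x = x - ?R *v (A *v (?R *v x))"
    by (simp add: normalized_laplacian_def sqrt_degree_matrix_def matrix_inv_diag_matrix[OF nz]
        matrix_vector_mult_diff_rdistrib matrix_vector_mul_assoc matrix_mul_assoc)
  then show ?thesis
    by (simp add: diag_matrix_mult_vec sqrt_vec_def matrix_vector_mult_def[of A])
qed

text \<open>\<open>D^(-1/2)\<close> turns \<open>d^(1/2)\<close> into the all-ones vector,
  \<open>A\<close> turns that into \<open>d\<close>, and \<open>D^(-1/2)\<close> returns
  \<open>d^(1/2)\<close>.\<close>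

lemma normalized_laplacian_sqrt_degree:
  assumes "\<And>i. 0 < degree_vec A $ i"
  shows "normalized_laplacian A *v sqrt_vec (degree_vec A) = 0"
proof -
  have "sqrt (degree_vec A $ j) \<noteq> 0" for j
    using assms[of j] by simp
  moreover have "(\<Sum>j\<in>UNIV. A $ i $ j) / sqrt (degree_vec A $ i) = sqrt (degree_vec A $ i)" for i
    using assms[of i] by (simp add: real_div_sqrt degree_vec_def)
  ultimately show ?thesis
    by (simp add: vec_eq_iff normalized_laplacian_mult_vec[OF assms] sqrt_vec_def)
qed

(* Evaluate the eigenvalue equation where the entry of D^(-1/2) x of largest absolute value occurs. *)
lemma normalized_laplacian_eigenvalue:
  fixes A :: "real^'n::finite^'n"
  assumes pos: "\<And>i. 0 < degree_vec A $ i" and A: "\<And>i j. 0 \<le> A $ i $ j"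
    and eig: "normalized_laplacian A *v x = w *\<^sub>R x" and "x \<noteq> 0"
  shows "w \<in> {0..2}"
proof -
  let ?d = "degree_vec A"
  define y where "y j = x $ j / sqrt (?d $ j)" for j
  have x: "x $ j = sqrt (?d $ j) * y j" for j
    using pos[of j] by (simp add: y_def)
  obtain i where i: "\<And>j. \<bar>y j\<bar> \<le> \<bar>y i\<bar>"
  proof -
    have "Max (range (\<lambda>j. \<bar>y j\<bar>)) \<in> range (\<lambda>j. \<bar>y j\<bar>)"
      by (rule Max_in) auto
    then obtain i where "Max (range (\<lambda>j. \<bar>y j\<bar>)) = \<bar>y i\<bar>"
      by blast
    then have "\<bar>y j\<bar> \<le> \<bar>y i\<bar>" for j
      by (metis Max_ge finite finite_imageI rangeI)
    then show thesis
      by (rule that)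
  qed
  have "y i \<noteq> 0"
  proof
    assume "y i = 0"
    then have "x = 0"
      using i by (simp add: vec_eq_iff x)
    with \<open>x \<noteq> 0\<close> show False ..
  qed
  have "(\<Sum>j\<in>UNIV. A $ i $ j * y j) / sqrt (?d $ i) = (1 - w) * x $ i"
    using arg_cong[OF eig, of "\<lambda>u. u $ i"]
    by (simp add: normalized_laplacian_mult_vec[OF pos] y_def algebra_simps)
  then have "(\<Sum>j\<in>UNIV. A $ i $ j * y j) = (1 - w) * x $ i * sqrt (?d $ i)"
    using pos[of i] by (simp add: field_simps)
  also have "\<dots> = (1 - w) * (?d $ i * y i)"
    using pos[of i] by (simp add: x less_imp_le)
  finally have "\<bar>1 - w\<bar> * (?d $ i * \<bar>y i\<bar>) = \<bar>\<Sum>j\<in>UNIV. A $ i $ j * y j\<bar>"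
    using pos[of i] by (simp add: abs_mult)
  also have "\<dots> \<le> (\<Sum>j\<in>UNIV. A $ i $ j * \<bar>y i\<bar>)"
    by (rule order_trans[OF sum_abs], rule sum_mono) (simp add: abs_mult A i mult_left_mono)
  also have "\<dots> = 1 * (?d $ i * \<bar>y i\<bar>)"
    by (simp add: degree_vec_def sum_distrib_right)
  finally have "\<bar>1 - w\<bar> \<le> 1"
    using pos[of i] \<open>y i \<noteq> 0\<close> mult_le_cancel_right_pos[of "?d $ i * \<bar>y i\<bar>"] by simp
  then show ?thesis
    by auto
qed

section \<open>Stability of the scattering transform under vertex permutations\<close>

theorem theorem3p8:
  fixes E :: "('n::{finite,linorder} \<times> 'n) set" and W :: "'n \<Rightarrow> 'n \<Rightarrow> real"
    and A M P :: "((real, 'n) vec, 'n) vec" and d :: "(real, 'n) vec"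
    and \<omega> :: "'n \<Rightarrow> real" and v :: "'n \<Rightarrow> (real, 'n) vec"
    and g :: "real \<Rightarrow> real" and lam :: "'n \<Rightarrow> real"
    and J :: nat and \<W> \<W>' :: "'n wavelets" and t :: real
    and \<pi> :: "'n \<Rightarrow> 'n" and x :: "(real, 'n) vec"
  assumes "weighted_graph E W" and "connected_graph E" and "CARD('n) \<ge> 2"
    and "A = adjacency E W" and "d = degree_vec A" and "M = sqrt_degree_matrix A"
    and "\<And>i. normalized_laplacian A *v v i = \<omega> i *\<^sub>R v i"
    and "\<And>i j. v i \<bullet> v j = (if i = j then 1 else 0)"
    and "mono \<omega>"
    and "v index0 = (1 / norm (sqrt_vec d)) *\<^sub>R sqrt_vec d"
    and "g \<in> {0..2} \<rightarrow> {0..1}" and "antimono_on {0..2} g" and "g 0 = 1" and "g 2 = 0"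
    and "\<And>i. lam i = g (\<omega> i)"
    and "(\<W> = wavelets1 J M v lam \<and> t = 2 powr (real J - 1)) \<or>
         (\<W> = wavelets2 J M v lam \<and> t = 2 ^ J)"
    and "\<pi> permutes UNIV" and "P = perm_matrix \<pi>"
    and "\<W>' = permuted_wavelets P \<W>"
  shows "finite_family_norm M (paths J)
           (\<lambda>js. scattering_S \<W>' js (P *v x) - scattering_S \<W> js x) \<and>
         family_norm M (paths J)
           (\<lambda>js. scattering_S \<W>' js (P *v x) - scattering_S \<W> js x)
         \<le> lam index1 powr t * weighted_opnorm M (P - mat 1)
            * sqrt (1 + norm1 d / min_entry d) * weighted_norm M x"
proof -
  have pos: "0 < degree_vec A $ i" for i
    using degree_vec_pos assms(1-3) unfolding assms(4) by blast
  have A: "0 \<le> A $ i $ j" for i j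
    unfolding assms(4) by (rule adjacency_nonneg[OF assms(1)])
  have v_nz: "v i \<noteq> 0" for i
    using assms(8)[of i i] by auto
  \<comment> \<open>The range and monotonicity of \<open>g\<close> are given only on
    \<open>{0..2}\<close>, so the spectrum has to be located there first.\<close>
  have \<omega>: "\<omega> i \<in> {0..2}" for i
    by (rule normalized_laplacian_eigenvalue[OF pos A assms(7) v_nz])
  \<comment> \<open>This forces \<open>\<omega> index0 = 0\<close>, hence
    \<open>lam index0 = g 0 = 1\<close>.\<close>
  have "normalized_laplacian A *v v index0 = 0"
    unfolding assms(10) assms(5)
    by (simp add: normalized_laplacian_sqrt_degree[OF pos] matrix_vector_mult_scaleR)
  then have "\<omega> index0 *\<^sub>R v index0 = 0"
    by (simp add: assms(7))
  then have lam0: "lam index0 = 1"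
    using v_nz assms(13,15) by simp
  have lam_range: "lam i \<in> {0..1}" for i
    unfolding assms(15) using assms(11) \<omega> by blast
  interpret degree_eigenbasis d v lam
    by unfold_locales (simp_all add: assms(5) pos assms(8) assms(10)[unfolded assms(5)] lam0 lam_range
        del: atLeastAtMost_iff)
  have M: "M = diag_matrix (sqrt_vec d)"
    by (simp add: assms(5,6) sqrt_degree_matrix_def)
  \<comment> \<open>\<open>index1\<close> is the least index other than \<open>index0\<close>,
    \<open>\<omega>\<close> increases and \<open>g\<close> decreases, so \<open>lam index1\<close>
    is the largest of the remaining values.\<close>
  have lam_le: "lam i \<le> lam index1" if "i \<noteq> index0" for i
  proof -
    have "index1 \<le> i"
      unfolding index1_def using that by (intro Min_le) auto
    then show ?thesis
      unfolding assms(15) using assms(9,12) \<omega> monotone_onD[of "{0..2}" "(\<le>)" "(\<ge>)" g]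
      by (meson monoD)
  qed
  have "0 < t"
    using assms(16) by auto
  then have powr_le: "\<bar>lam i powr t\<bar> \<le> lam index1 powr t" if "i \<noteq> index0" for i
    using lam_le[OF that] lam_range[of i] by (auto intro: powr_mono2)
  show ?thesis
    using assms(16)
  proof (elim disjE conjE)
    assume W: "\<W> = wavelets1 J M v lam" and t: "t = 2 powr (real J - 1)"
    show ?thesis
      unfolding assms(19) M
    proof (rule scattering_perm_le[OF assms(17,18), of \<W> "q_fun J" "q_fun J (J + 1)"])
      show "\<bar>q_fun J (J + 1) (lam i)\<bar> \<le> lam index1 powr t" if "i \<noteq> index0" for i
        using powr_le[OF that] lam_range[of i] t by (simp only: low_pass_q atLeastAtMost_iff)
      show "q_fun J (J + 1) 1 = 1"
        by (simp add: q_fun_def p_fun_def)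
    \<comment> \<open>Unfolding \<open>q_fun\<close> only at the argument \<open>1\<close> shows
      that the band-pass filters vanish there, while the Bessel bound stays expressed through
      \<open>q_fun\<close>.\<close>
    qed (simp_all add: W wavelets1_def M sum_q_fun_squared_le_1 q_fun_def[of _ _ 1] p_fun_1)
  next
    assume W: "\<W> = wavelets2 J M v lam" and t: "t = 2 ^ J"
    show ?thesis
      unfolding assms(19) M
    proof (rule scattering_perm_le[OF assms(17,18), of \<W> "p_fun J" "p_fun J (J + 1)"])
      show "\<bar>p_fun J (J + 1) (lam i)\<bar> \<le> lam index1 powr t" if "i \<noteq> index0" for i
        using powr_le[OF that] lam_range[of i] t by (simp only: low_pass_p atLeastAtMost_iff)
      show "p_fun J (J + 1) 1 = 1"
        by (simp add: p_fun_def)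
    qed (simp_all add: W wavelets2_def M sum_p_fun_squared_le_1 p_fun_1)
  qed
qed

end
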